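(* Let $\psi$ be an Orlicz function. Consider the linear regression model $Y_i=\beta^T Z_i+\epsilon_i$, $i=1,2,\ldots$, with coefficient vector $\beta\in\mathbb{R}^d$, covariates $Z_i=(Z_{i,1},\ldots,Z_{i,d})^T\in\mathbb{R}^d$, and i.i.d. centered real-valued error terms $\epsilon_i$, distributed as $\epsilon$. Suppose that the $Z_i$ are i.i.d., and that $\widehat\beta=\widehat\beta_n$ is an estimator of $\beta$ with $\widehat\beta\to\beta$ almost surely as $n\to\infty$. If $\sigma_\psi=\|\epsilon\|_\psi<\infty$ and $\|Z_{i,j}\|_\psi<\infty$ for each coordinate $j=1,\ldots,d$, then the residual-based estimator $$\widehat\sigma_{\psi,\mathrm{LM}}=\widehat\sigma_\psi\big(Y_1-\widehat\beta^T Z_1,\ldots,Y_n-\widehat\beta^T Z_n\big)$$ satisfies $\widehat\sigma_{\psi,\mathrm{LM}}\to\sigma_\psi$ almost surely as $n\to\infty$.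
   Context: An Orlicz function is a function $\psi:[0,\infty)\to[0,\infty)$ that is increasing and convex, with $\psi(0)=0$ and $\psi(x)\to\infty$ as $x\to\infty$. For a real random variable $X$, the Orlicz norm is $\|X\|_\psi=\inf\{\sigma>0 : \mathbb{E}\,\psi(|X|/\sigma)\le 1\}$ (with $\inf\emptyset=\infty$). The empirical Orlicz norm of $x_1,\ldots,x_n$ is $$\widehat{\sigma}_\psi(x_1,\ldots,x_n)=\inf\Big\{\sigma>0 : \frac1n\sum_{i=1}^n\psi\Big(\frac{|x_i|}{\sigma}\Big)\le 1\Big\}.$$ *)

theory Defs
  imports "HOL-Probability.Probability"
begin

text \<open>
  The values of \<open>\<psi>\<close> on negative reals are irrelevant.  ``Increasing'' is read as
  nondecreasing, which includes the strictly increasing case.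
\<close>

definition orlicz_function :: "(real \<Rightarrow> real) \<Rightarrow> bool" where
  "orlicz_function \<psi> \<longleftrightarrow>
     (\<forall>x\<ge>0. 0 \<le> \<psi> x) \<and> mono_on {0..} \<psi> \<and> convex_on {0..} \<psi> \<and> \<psi> 0 = 0 \<and>
     filterlim \<psi> at_top at_top"

text \<open>
  Both norms take values in \<^typ>\<open>ennreal\<close>, so that the infimum of the empty set is
  \<open>\<infinity>\<close>, and the expectation is a nonnegative integral because it may be infinite.
\<close>

definition orlicz_norm :: "'a measure \<Rightarrow> (real \<Rightarrow> real) \<Rightarrow> ('a \<Rightarrow> real) \<Rightarrow> ennreal" where
  "orlicz_norm M \<psi> X =
     Inf {ennreal \<sigma> |\<sigma>. 0 < \<sigma> \<and> (\<integral>\<^sup>+\<omega>. ennreal (\<psi> (\<bar>X \<omega>\<bar> / \<sigma>)) \<partial>M) \<le> 1}"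

definition empirical_orlicz_norm :: "(real \<Rightarrow> real) \<Rightarrow> nat \<Rightarrow> (nat \<Rightarrow> real) \<Rightarrow> ennreal" where
  "empirical_orlicz_norm \<psi> n x =
     Inf {ennreal \<sigma> |\<sigma>. 0 < \<sigma> \<and> (1 / real n) * (\<Sum>i=1..n. \<psi> (\<bar>x i\<bar> / \<sigma>)) \<le> 1}"

text \<open>Sequences are indexed from 1; the value at index 0 is ignored.\<close>

definition iid_seq :: "'a measure \<Rightarrow> 'b measure \<Rightarrow> (nat \<Rightarrow> 'a \<Rightarrow> 'b) \<Rightarrow> bool" where
  "iid_seq M N X \<longleftrightarrow>
     prob_space.indep_vars M (\<lambda>_. N) X {1..} \<and>
     (\<forall>i\<ge>1. distr M N (X i) = distr M N (X 1))"

end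

theory Submission
  imports Defs
begin

text \<open>
  For fixed \<open>s > 0\<close>, the strong law of large numbers applied to \<open>\<psi>(|\<epsilon>\<^sub>i|/s)\<close> (with possibly infinite mean)
  shows that \<open>s\<close> is eventually admissible for the errors if \<open>s > \<sigma>\<^sub>\<psi>\<close> and eventually not if
  \<open>s < \<sigma>\<^sub>\<psi>\<close>; rational \<open>s\<close> suffice.  The residuals differ from the errors by at most
  \<open>|\<beta> - \<beta>hat| |Z\<^sub>i|\<close>, whose empirical Orlicz norm tends to 0 because that of \<open>|Z\<^sub>i|\<close> is
  eventually bounded, so the triangle inequality transfers the conclusion to the residuals.

  The strong law comes from Garsia's maximal argument.  If \<open>E X < 0\<close> and the partial sums were
  unbounded with positive probability, they would be unbounded almost surely by Kolmogorov's 0-1 law.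
  The running maximum \<open>M\<^sub>n\<close> satisfies \<open>M\<^sub>n\<^sub>+\<^sub>1 - M'\<^sub>n = max (-M'\<^sub>n) X\<^sub>0\<close>, where \<open>M'\<^sub>n\<close> is
  the maximum of the shifted walk and has the law of \<open>M\<^sub>n\<close>.  The left side has nonnegative mean, and the
  right side converges to \<open>X\<^sub>0\<close>, so \<open>E X \<ge> 0\<close>, a contradiction.
\<close>

section \<open>I.i.d. sequences under reindexing and composition\<close>

lemma (in prob_space) indep_sets_reindex:
  assumes "indep_sets F (f ` I)" "inj_on f I"
  shows "indep_sets (\<lambda>i. F (f i)) I"
proof (rule indep_setsI)
  show "F (f i) \<subseteq> events" if "i \<in> I" for i
    using assms(1) that by (auto simp: indep_sets_def)
next
  fix A J assume J: "J \<noteq> {}" "J \<subseteq> I" "finite J" and A: "\<forall>j\<in>J. A j \<in> F (f j)"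
  have inj: "inj_on f J"
    using assms(2) J(2) by (rule inj_on_subset)
  \<comment> \<open>The family is carried to the image of \<open>J\<close> along the inverse of
    \<open>f\<close>; injectivity then turns the product formula over the image into one over
    \<open>J\<close>.\<close>
  have "prob (\<Inter>k\<in>f ` J. A (the_inv_into J f k)) = (\<Prod>k\<in>f ` J. prob (A (the_inv_into J f k)))"
    using J A inj by (intro indep_setsD[OF assms(1)]) (auto simp: the_inv_into_f_f)
  then show "prob (\<Inter>j\<in>J. A j) = (\<Prod>j\<in>J. prob (A j))"
    using inj by (simp add: prod.reindex the_inv_into_f_f cong: INF_cong prod.cong)
qed

lemma (in prob_space) indep_vars_reindex:
  assumes "indep_vars N X (f ` I)" "inj_on f I"
  shows "indep_vars (\<lambda>i. N (f i)) (\<lambda>i. X (f i)) I"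
proof -
  have "indep_sets (\<lambda>i. {X i -` A \<inter> space M |A. A \<in> sets (N i)}) (f ` I)"
    using assms(1) by (simp add: indep_vars_def2)
  from indep_sets_reindex[OF this assms(2)] show ?thesis
    using assms(1) by (simp add: indep_vars_def2)
qed

lemma (in prob_space) iid_seq_shift:
  assumes "iid_seq M N X"
  shows "indep_vars (\<lambda>_. N) (\<lambda>i. X (Suc i)) UNIV"
    and "distr M N (X (Suc i)) = distr M N (X 1)"
proof -
  have "Suc ` UNIV = {1..}"
    by (auto simp: image_iff Suc_le_eq gr0_conv_Suc)
  then show "indep_vars (\<lambda>_. N) (\<lambda>i. X (Suc i)) UNIV"
    using assms indep_vars_reindex[of "\<lambda>_. N" X Suc UNIV] by (simp add: iid_seq_def)
  have "1 \<le> Suc i"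
    by simp
  with assms show "distr M N (X (Suc i)) = distr M N (X 1)"
    unfolding iid_seq_def by blast
qed

lemma (in prob_space) iid_seq_measurable:
  assumes "iid_seq M N X" "i \<ge> 1"
  shows "X i \<in> measurable M N"
  using assms by (auto simp: iid_seq_def indep_vars_def)

lemma (in prob_space) iid_seq_compose:
  assumes X: "iid_seq M N X" and g: "g \<in> measurable N K"
  shows "iid_seq M K (\<lambda>i \<omega>. g (X i \<omega>))"
  unfolding iid_seq_def
proof (intro conjI allI impI)
  show "indep_vars (\<lambda>_. K) (\<lambda>i \<omega>. g (X i \<omega>)) {1..}"
    using X g by (intro indep_vars_compose2[where Y = "\<lambda>_. g"]) (auto simp: iid_seq_def)
  fix i :: nat assume "i \<ge> 1"
  have law: "distr M K (\<lambda>\<omega>. g (X j \<omega>)) = distr (distr M N (X j)) K g" if "j \<ge> 1" for j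
    using distr_distr[OF g iid_seq_measurable[OF X that]] by (simp add: comp_def)
  have "distr M N (X i) = distr M N (X 1)"
    using X \<open>i \<ge> 1\<close> unfolding iid_seq_def by blast
  then show "distr M K (\<lambda>\<omega>. g (X i \<omega>)) = distr M K (\<lambda>\<omega>. g (X 1 \<omega>))"
    by (simp only: law[OF \<open>i \<ge> 1\<close>] law[OF order_refl])
qed

section \<open>Running maxima and the strong law\<close>

text \<open>This is the maximum of the partial sums of at most \<open>n\<close> leading terms, the
  empty sum included. Peeling off the first summand instead of the last makes the maximum of the
  shifted walk appear, which is the form of Garsia's identity.\<close>

primrec run_max :: "nat \<Rightarrow> (nat \<Rightarrow> real) \<Rightarrow> real" where
  "run_max 0 x = 0"
| "run_max (Suc n) x = max 0 (x 0 + run_max n (\<lambda>i. x (Suc i)))"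

lemma run_max_nonneg: "0 \<le> run_max n x"
  by (cases n) auto

lemma run_max_le_Suc: "run_max n x \<le> run_max (Suc n) x"
proof (induction n arbitrary: x)
  case (Suc n)
  show ?case
    using Suc[of "\<lambda>i. x (Suc i)"] by (subst (1 2) run_max.simps(2)) linarith
qed simp

lemma incseq_run_max: "incseq (\<lambda>n. run_max n x)"
  by (intro incseq_SucI run_max_le_Suc)

lemma sum_le_run_max: "(\<Sum>i<n. x i) \<le> run_max n x"
proof (induction n arbitrary: x)
  case (Suc n)
  show ?case
    using Suc[of "\<lambda>i. x (Suc i)"] by (auto simp: sum.lessThan_Suc_shift simp del: sum.lessThan_Suc)
qed simp

text \<open>Letting the whole sequence depend on the outcome admits the shifted sequence in the
  induction and, later, the identity on the product space.\<close>

lemma measurable_run_max: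
  assumes "\<And>i. (\<lambda>\<omega>. X \<omega> i) \<in> borel_measurable M"
  shows "(\<lambda>\<omega>. run_max n (X \<omega>)) \<in> borel_measurable M"
  using assms
proof (induction n arbitrary: X)
  case (Suc n)
  have "(\<lambda>\<omega>. run_max n (\<lambda>i. X \<omega> (Suc i))) \<in> borel_measurable M"
    by (rule Suc.IH) (rule Suc.prems)
  with Suc.prems[of 0] show ?case
    by simp
qed simp

lemma integrable_run_max:
  assumes "\<And>i. integrable M (\<lambda>\<omega>. X \<omega> i)"
  shows "integrable M (\<lambda>\<omega>. run_max n (X \<omega>))"
  using assms
proof (induction n arbitrary: X)
  case (Suc n)
  have "integrable M (\<lambda>\<omega>. run_max n (\<lambda>i. X \<omega> (Suc i)))"
    by (rule Suc.IH) (rule Suc.prems)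
  with Suc.prems[of 0] show ?case
    by simp
qed simp

text \<open>Dropping finitely many terms changes all later partial sums by one constant. Hence
  boundedness is a tail property.\<close>

lemma partial_sums_bounded_shift:
  fixes x :: "nat \<Rightarrow> real"
  shows "(\<exists>C. \<forall>k. (\<Sum>i<k. x i) \<le> C) \<longleftrightarrow> (\<exists>C. \<forall>k. (\<Sum>i<k. x (n + i)) \<le> C)"
proof (induction n)
  case (Suc n)
  have "(\<exists>C. \<forall>k. (\<Sum>i<k. y i) \<le> C) \<longleftrightarrow> (\<exists>C. \<forall>k. (\<Sum>i<k. y (Suc i)) \<le> C)"
    for y :: "nat \<Rightarrow> real"
  proof safe
    fix C assume C: "\<forall>k. (\<Sum>i<k. y i) \<le> C"
    have "(\<Sum>i<k. y (Suc i)) \<le> C - y 0" for k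
      using C[rule_format, of "Suc k"] by (simp add: sum.lessThan_Suc_shift del: sum.lessThan_Suc)
    then show "\<exists>C. \<forall>k. (\<Sum>i<k. y (Suc i)) \<le> C"
      by blast
  next
    fix C assume C: "\<forall>k. (\<Sum>i<k. y (Suc i)) \<le> C"
    \<comment> \<open>The 0 covers the empty sum, \<open>k = 0\<close>.\<close>
    have "(\<Sum>i<k. y i) \<le> max 0 (y 0 + C)" for k
    proof (cases k)
      case (Suc m)
      then show ?thesis
        using C[rule_format, of m]
        by (simp add: sum.lessThan_Suc_shift le_max_iff_disj del: sum.lessThan_Suc)
    qed simp
    then show "\<exists>C. \<forall>k. (\<Sum>i<k. y i) \<le> C"
      by blast
  qed
  from this[of "\<lambda>i. x (n + i)"] Suc show ?case
    by simp
qed simp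

lemma (in prob_space) partial_sums_bounded_0_1:
  fixes X :: "nat \<Rightarrow> 'a \<Rightarrow> real"
  assumes ind: "indep_vars (\<lambda>_. borel) X UNIV"
  shows "(AE \<omega> in M. \<exists>C. \<forall>k. (\<Sum>i<k. X i \<omega>) \<le> C) \<or> (AE \<omega> in M. \<not> (\<exists>C. \<forall>k. (\<Sum>i<k. X i \<omega>) \<le> C))"
proof -
  define B where "B = {\<omega> \<in> space M. \<exists>C. \<forall>k. (\<Sum>i<k. X i \<omega>) \<le> C}"
  define A where "A = (\<lambda>i. sigma_sets (space M) {X i -` S \<inter> space M |S. S \<in> sets borel})"
  have A: "indep_sets A UNIV"
    using ind unfolding indep_vars_def A_def by simp
  have rv[measurable]: "X i \<in> borel_measurable M" for i
    using ind unfolding indep_vars_def by simp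
  have tail: "B \<in> tail_events A"
    unfolding tail_events_def
  proof
    fix n
    \<comment> \<open>\<open>N\<close> is generated by the variables from index \<open>n\<close> on,
      so a tail event becomes a set measurable in \<open>N\<close>.\<close>
    define N where "N = sigma (space M) (\<Union> (A ` {n..}))"
    have sub: "\<Union> (A ` {n..}) \<subseteq> Pow (space M)"
      unfolding A_def by (auto dest: sigma_sets_into_sp[rotated])
    have spN: "space N = space M"
      by (simp add: N_def space_measure_of[OF sub])
    have meas[measurable]: "X (n + i) \<in> borel_measurable N" for i
    proof (rule measurableI)
      fix S :: "real set" assume "S \<in> sets borel"
      then have "X (n + i) -` S \<inter> space M \<in> A (n + i)"
        unfolding A_def by (intro sigma_sets.Basic) auto
      then have "X (n + i) -` S \<inter> space M \<in> sigma_sets (space M) (\<Union> (A ` {n..}))"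
        by (intro sigma_sets.Basic) auto
      then show "X (n + i) -` S \<inter> space N \<in> sets N"
        by (simp add: spN) (simp add: N_def sets_measure_of[OF sub])
    qed simp
    \<comment> \<open>A natural bound \<open>C\<close> keeps the quantifiers countable, so the set
      is visibly measurable.\<close>
    have "B = {\<omega> \<in> space N. \<exists>C::nat. \<forall>k. (\<Sum>i<k. X (n + i) \<omega>) \<le> real C}"
      unfolding B_def spN partial_sums_bounded_shift[of "\<lambda>i. X i _" n]
      by (meson order_trans real_arch_simple)
    also have "\<dots> \<in> sets N"
      by measurable
    finally show "B \<in> sigma_sets (space M) (\<Union> (A ` {n..}))"
      by (simp add: N_def sets_measure_of[OF sub])
  qed
  have "B \<in> events"
    using tail_events_sets[of A] A tail by (auto simp: indep_sets_def)
  moreover have "prob B = 0 \<or> prob B = 1"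
    using A tail by (intro kolmogorov_0_1_law[of A])
      (auto simp: A_def intro!: sigma_algebra_sigma_sets)
  ultimately have "(AE \<omega> in M. \<omega> \<notin> B) \<or> (AE \<omega> in M. \<omega> \<in> B)"
    using prob_eq_0[of B] AE_prob_1[of B] by blast
  moreover have "(AE \<omega> in M. \<omega> \<in> B) \<longleftrightarrow> (AE \<omega> in M. \<exists>C. \<forall>k. (\<Sum>i<k. X i \<omega>) \<le> C)"
    "(AE \<omega> in M. \<omega> \<notin> B) \<longleftrightarrow> (AE \<omega> in M. \<not> (\<exists>C. \<forall>k. (\<Sum>i<k. X i \<omega>) \<le> C))"
    by (auto simp: B_def intro!: AE_cong)
  ultimately show ?thesis
    by blast
qed

text \<open>By independence the joint law is the product of the marginals, which the shift does not
  change; the expectation depends on the joint law only.\<close>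

lemma (in prob_space) expectation_run_max_shift:
  fixes X :: "nat \<Rightarrow> 'a \<Rightarrow> real"
  assumes ind: "indep_vars (\<lambda>_. borel) X UNIV"
    and law: "\<And>i. distr M borel (X i) = distr M borel (X 0)"
  shows "expectation (\<lambda>\<omega>. run_max n (\<lambda>i. X (Suc i) \<omega>)) = expectation (\<lambda>\<omega>. run_max n (\<lambda>i. X i \<omega>))"
proof -
  have rv[measurable]: "X i \<in> borel_measurable M" for i
    using ind unfolding indep_vars_def by simp
  have ind': "indep_vars (\<lambda>_. borel) (\<lambda>i. X (Suc i)) UNIV"
    using indep_vars_reindex[of "\<lambda>_. borel" X Suc UNIV] indep_vars_subset[OF ind] by simp
  have "distr M (Pi\<^sub>M UNIV (\<lambda>_. borel)) (\<lambda>\<omega> i. X (Suc i) \<omega>) = Pi\<^sub>M UNIV (\<lambda>i. distr M borel (X (Suc i)))"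
    using indep_vars_iff_distr_eq_PiM[of UNIV "\<lambda>i. X (Suc i)" "\<lambda>_. borel"] ind' by (simp add: restrict_def)
  also have "\<dots> = Pi\<^sub>M UNIV (\<lambda>i. distr M borel (X i))"
    by (intro PiM_cong refl) (metis law)
  also have "\<dots> = distr M (Pi\<^sub>M UNIV (\<lambda>_. borel)) (\<lambda>\<omega> i. X i \<omega>)"
    using indep_vars_iff_distr_eq_PiM[of UNIV X "\<lambda>_. borel"] ind by (simp add: restrict_def)
  finally have eq: "distr M (Pi\<^sub>M UNIV (\<lambda>_. borel)) (\<lambda>\<omega> i. X (Suc i) \<omega>) =
    distr M (Pi\<^sub>M UNIV (\<lambda>_. borel)) (\<lambda>\<omega> i. X i \<omega>)" .
  have [measurable]: "run_max n \<in> borel_measurable (Pi\<^sub>M UNIV (\<lambda>_. borel))"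
    by (rule measurable_run_max) simp
  have "expectation (\<lambda>\<omega>. run_max n (\<lambda>i. X (Suc i) \<omega>)) =
      integral\<^sup>L (distr M (Pi\<^sub>M UNIV (\<lambda>_. borel)) (\<lambda>\<omega> i. X (Suc i) \<omega>)) (run_max n)"
    by (subst integral_distr) (auto intro!: measurable_PiM_single')
  also have "\<dots> = expectation (\<lambda>\<omega>. run_max n (\<lambda>i. X i \<omega>))"
    unfolding eq by (subst integral_distr) (auto intro!: measurable_PiM_single')
  finally show ?thesis .
qed

lemma (in prob_space) AE_partial_sums_bounded:
  fixes X :: "nat \<Rightarrow> 'a \<Rightarrow> real"
  assumes ind: "indep_vars (\<lambda>_. borel) X UNIV"
    and law: "\<And>i. distr M borel (X i) = distr M borel (X 0)"
    and int: "integrable M (X 0)" and neg: "expectation (X 0) < 0"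
  shows "AE \<omega> in M. \<exists>C. \<forall>k. (\<Sum>i<k. X i \<omega>) \<le> C"
proof (rule ccontr)
  assume "\<not> ?thesis"
  with partial_sums_bounded_0_1[OF ind]
  have unb: "AE \<omega> in M. \<not> (\<exists>C. \<forall>k. (\<Sum>i<k. X i \<omega>) \<le> C)"
    by blast
  have rv[measurable]: "X i \<in> borel_measurable M" for i
    using ind unfolding indep_vars_def by simp
  have intX: "integrable M (X i)" for i
  proof -
    \<comment> \<open>Integrability depends only on the law, so it passes from \<open>X 0\<close> to
      every \<open>X i\<close>.\<close>
    have "integrable (distr M borel (X i)) (\<lambda>x. x)"
      unfolding law[of i] using int by (simp add: integrable_distr_eq)
    then show ?thesis
      by (simp add: integrable_distr_eq)
  qed
  define D where "D = (\<lambda>n \<omega>. run_max (Suc n) (\<lambda>i. X i \<omega>) - run_max n (\<lambda>i. X (Suc i) \<omega>))"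
  have D_eq: "D n \<omega> = max (- run_max n (\<lambda>i. X (Suc i) \<omega>)) (X 0 \<omega>)" for n \<omega>
    by (simp add: D_def max_def)
  have nonneg: "0 \<le> expectation (D n)" for n
  proof -
    have "expectation (D n) = expectation (\<lambda>\<omega>. run_max (Suc n) (\<lambda>i. X i \<omega>)) - expectation (\<lambda>\<omega>. run_max n (\<lambda>i. X i \<omega>))"
      unfolding D_def expectation_run_max_shift[OF ind law, of n, symmetric]
      by (intro Bochner_Integration.integral_diff integrable_run_max intX)
    \<comment> \<open>Since the shifted maximum has the mean of the unshifted one, monotonicity of
      the running maximum in \<open>n\<close> gives the sign.\<close>
    moreover have "expectation (\<lambda>\<omega>. run_max n (\<lambda>i. X i \<omega>)) \<le> expectation (\<lambda>\<omega>. run_max (Suc n) (\<lambda>i. X i \<omega>))"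
      by (intro integral_mono integrable_run_max intX run_max_le_Suc)
    ultimately show ?thesis
      by simp
  qed
  have "(\<lambda>n. expectation (D n)) \<longlonglongrightarrow> expectation (X 0)"
  proof (rule integral_dominated_convergence[where w = "\<lambda>\<omega>. \<bar>X 0 \<omega>\<bar>"])
    show "D n \<in> borel_measurable M" for n
      unfolding D_def by (intro borel_measurable_diff measurable_run_max) auto
    \<comment> \<open>The shifted maximum is nonnegative, so \<open>D n\<close> lies between
      \<open>X 0\<close> and \<open>max 0 (X 0)\<close>. This dominates it however large the maxima
      become.\<close>
    show "AE \<omega> in M. norm (D n \<omega>) \<le> \<bar>X 0 \<omega>\<bar>" for n
      by (intro AE_I2) (auto simp: D_eq max_def run_max_nonneg intro: order_trans[OF _ run_max_nonneg])
    show "AE \<omega> in M. (\<lambda>n. D n \<omega>) \<longlonglongrightarrow> X 0 \<omega>"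
      using unb
    proof eventually_elim
      case (elim \<omega>)
      then have "\<not> (\<exists>C. \<forall>k. (\<Sum>i<k. X (Suc i) \<omega>) \<le> C)"
        using partial_sums_bounded_shift[of "\<lambda>i. X i \<omega>" 1] by simp
      then obtain k where "- X 0 \<omega> < (\<Sum>i<k. X (Suc i) \<omega>)"
        by (meson not_le)
      then have k: "- X 0 \<omega> < run_max k (\<lambda>i. X (Suc i) \<omega>)"
        using sum_le_run_max[of "\<lambda>i. X (Suc i) \<omega>" k] by linarith
      \<comment> \<open>On an unbounded path \<open>D n\<close> is not merely close to
        \<open>X 0\<close> but eventually equal to it.\<close>
      have "D n \<omega> = X 0 \<omega>" if "n \<ge> k" for n
        using incseqD[OF incseq_run_max that, of "\<lambda>i. X (Suc i) \<omega>"] k by (simp add: D_eq)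
      then show ?case
        by (intro tendsto_eventually) (auto simp: eventually_sequentially)
    qed
  qed (use int in auto)
  then have "0 \<le> expectation (X 0)"
    using nonneg by (intro LIMSEQ_le_const) auto
  with neg show False
    by simp
qed

section \<open>One-sided strong laws\<close>

lemma (in prob_space) iid_mean_less:
  assumes iid: "iid_seq M borel X"
    and int: "integrable M (X 1)" and less: "expectation (X 1) < c"
  shows "AE \<omega> in M. \<forall>\<^sub>F n in sequentially. (1 / real n) * (\<Sum>i=1..n. X i \<omega>) < c"
proof -
  \<comment> \<open>Centering at \<open>c'\<close> keeps the increments of negative mean, and the
    gap \<open>c - c'\<close> absorbs the random bound \<open>C\<close> on the walk.\<close>
  obtain c' where c': "expectation (X 1) < c'" "c' < c"
    using less dense by blast
  have iid': "iid_seq M borel (\<lambda>i \<omega>. X i \<omega> - c')"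
    by (rule iid_seq_compose[OF iid]) simp
  have "AE \<omega> in M. \<exists>C. \<forall>k. (\<Sum>i<k. X (Suc i) \<omega> - c') \<le> C"
    using iid_seq_shift[OF iid'] int c'(1)
    by (intro AE_partial_sums_bounded) (simp_all add: prob_space)
  then show ?thesis
  proof eventually_elim
    case (elim \<omega>)
    then obtain C where C: "(\<Sum>i<k. X (Suc i) \<omega> - c') \<le> C" for k
      by blast
    have "\<forall>\<^sub>F n in sequentially. real n > max 0 (C / (c - c'))"
      using filterlim_real_sequentially by (rule filterlim_at_top_dense[THEN iffD1, rule_format])
    then show ?case
    proof eventually_elim
      case (elim n)
      have "(\<Sum>i=1..n. X i \<omega>) = (\<Sum>i<n. X (Suc i) \<omega> - c') + real n * c'"
        by (simp add: sum_subtractf sum.atLeast1_atMost_eq)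
      also have "\<dots> \<le> C + real n * c'"
        using C by simp
      \<comment> \<open>This is \<open>real n > C / (c - c')\<close> rearranged; the 0 in the
        threshold makes \<open>n\<close> positive for the division below.\<close>
      also have "\<dots> < real n * c"
        using elim c'(2) by (simp add: field_simps)
      finally show ?case
        using elim by (simp add: field_simps)
    qed
  qed
qed

lemma (in prob_space) iid_mean_less_one:
  assumes iid: "iid_seq M borel X" and nonneg: "\<And>\<omega>. 0 \<le> X 1 \<omega>"
    and less: "(\<integral>\<^sup>+\<omega>. ennreal (X 1 \<omega>) \<partial>M) < 1"
  shows "AE \<omega> in M. \<forall>\<^sub>F n in sequentially. (1 / real n) * (\<Sum>i=1..n. X i \<omega>) < 1"
proof (rule iid_mean_less[OF iid])
  have "X 1 \<in> borel_measurable M"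
    using iid by (rule iid_seq_measurable) simp
  then show int: "integrable M (X 1)"
    using nonneg less by (intro integrableI_nonneg) (simp_all add: less_trans[OF _ ennreal_one_less_top])
  show "expectation (X 1) < 1"
    using less nn_integral_eq_integral[OF int] nonneg by simp
qed

text \<open>The mean may be infinite, so \<open>X\<close> is truncated at \<open>K\<close>. Monotone
  convergence gives a \<open>K\<close> whose truncated mean still exceeds 1, and the upper bound on
  means is applied to the negated truncations.\<close>

lemma (in prob_space) iid_mean_greater_one:
  assumes iid: "iid_seq M borel X" and nonneg: "\<And>i \<omega>. 0 \<le> X i \<omega>"
    and greater: "1 < (\<integral>\<^sup>+\<omega>. ennreal (X 1 \<omega>) \<partial>M)"
  shows "AE \<omega> in M. \<forall>\<^sub>F n in sequentially. 1 < (1 / real n) * (\<Sum>i=1..n. X i \<omega>)"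
proof -
  have [measurable]: "X 1 \<in> borel_measurable M"
    using iid by (rule iid_seq_measurable) simp
  have "(\<lambda>K. \<integral>\<^sup>+\<omega>. ennreal (min (X 1 \<omega>) (real K)) \<partial>M) \<longlonglongrightarrow> (\<integral>\<^sup>+\<omega>. ennreal (X 1 \<omega>) \<partial>M)"
  proof (rule nn_integral_LIMSEQ)
    show "incseq (\<lambda>K \<omega>. ennreal (min (X 1 \<omega>) (real K)))"
      by (intro incseq_SucI le_funI ennreal_leI) auto
    fix \<omega>
    have "\<forall>\<^sub>F K in sequentially. ennreal (min (X 1 \<omega>) (real K)) = ennreal (X 1 \<omega>)"
      using eventually_ge_at_top[of "nat \<lceil>X 1 \<omega>\<rceil>"]
      by eventually_elim (simp add: min_absorb1 nat_ceiling_le_eq)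
    then show "(\<lambda>K. ennreal (min (X 1 \<omega>) (real K))) \<longlonglongrightarrow> ennreal (X 1 \<omega>)"
      by (rule tendsto_eventually)
  qed measurable
  then have "\<forall>\<^sub>F K in sequentially. 1 < (\<integral>\<^sup>+\<omega>. ennreal (min (X 1 \<omega>) (real K)) \<partial>M)"
    using greater by (rule order_tendstoD)
  then obtain K where K: "1 < (\<integral>\<^sup>+\<omega>. ennreal (min (X 1 \<omega>) (real K)) \<partial>M)"
    by (auto simp: eventually_sequentially)
  have int: "integrable M (\<lambda>\<omega>. min (X 1 \<omega>) (real K))"
    using nonneg by (intro integrable_const_bound[of _ "real K"]) (auto simp del: One_nat_def)
  have "1 < expectation (\<lambda>\<omega>. min (X 1 \<omega>) (real K))"
    using K nn_integral_eq_integral[OF int] nonneg by simp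
  moreover have "iid_seq M borel (\<lambda>i \<omega>. - min (X i \<omega>) (real K))"
    by (rule iid_seq_compose[OF iid]) simp
  ultimately have "AE \<omega> in M. \<forall>\<^sub>F n in sequentially. (1 / real n) * (\<Sum>i=1..n. - min (X i \<omega>) (real K)) < -1"
    using int by (intro iid_mean_less) auto
  then show ?thesis
  proof eventually_elim
    case (elim \<omega>)
    then show ?case
    proof eventually_elim
      case (elim n)
      have "(1 / real n) * (\<Sum>i=1..n. min (X i \<omega>) (real K)) \<le> (1 / real n) * (\<Sum>i=1..n. X i \<omega>)"
        by (intro mult_left_mono sum_mono) auto
      with elim show ?case
        by (simp add: sum_negf)
    qed
  qed
qed

section \<open>Orlicz norms\<close>

lemma
  assumes "orlicz_function \<psi>"
  shows orlicz_nonneg: "0 \<le> x \<Longrightarrow> 0 \<le> \<psi> x"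
    and orlicz_mono: "0 \<le> x \<Longrightarrow> x \<le> y \<Longrightarrow> \<psi> x \<le> \<psi> y"
    and orlicz_convex: "convex_on {0..} \<psi>"
  using assms by (auto simp: orlicz_function_def mono_on_def)

text \<open>Convexity on the segment from 0 to \<open>x\<close>, where \<open>\<psi>\<close>
  vanishes at 0.\<close>

lemma orlicz_scale:
  assumes \<psi>: "orlicz_function \<psi>" and "0 \<le> x" "0 \<le> l" "l \<le> 1"
  shows "\<psi> (l * x) \<le> l * \<psi> x"
  using convex_onD[OF orlicz_convex[OF \<psi>], of l 0 x] assms by (simp add: orlicz_function_def)

lemma measurable_orlicz:
  assumes \<psi>: "orlicz_function \<psi>" and [measurable]: "X \<in> borel_measurable M"
  shows "(\<lambda>\<omega>. \<psi> \<bar>X \<omega>\<bar>) \<in> borel_measurable M"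
proof -
  \<comment> \<open>\<open>\<psi>\<close> is arbitrary on negative reals; composing with
    \<open>max 0\<close> gives a function monotone on the whole line, hence Borel.\<close>
  have "(\<lambda>x. \<psi> (max 0 x)) \<in> borel_measurable borel"
    by (rule borel_measurable_mono) (auto simp: mono_def intro!: orlicz_mono[OF \<psi>])
  then have "(\<lambda>\<omega>. \<psi> (max 0 \<bar>X \<omega>\<bar>)) \<in> borel_measurable M"
    by measurable
  then show ?thesis
    by simp
qed

lemma measurable_orlicz_scaled:
  assumes \<psi>: "orlicz_function \<psi>" and [measurable]: "X \<in> borel_measurable M" and "0 < s"
  shows "(\<lambda>\<omega>. \<psi> (\<bar>X \<omega>\<bar> / s)) \<in> borel_measurable M"
  using measurable_orlicz[OF \<psi>, of "\<lambda>\<omega>. X \<omega> / s" M] \<open>0 < s\<close> by simp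

text \<open>Some \<open>t < s\<close> has expectation at most 1, and convexity gains the factor
  \<open>t / s\<close> when passing to \<open>s\<close>. The resulting strict inequality is what the
  strong law can use.\<close>

lemma nn_integral_orlicz_less_one:
  assumes \<psi>: "orlicz_function \<psi>" and X[measurable]: "X \<in> borel_measurable M"
    and less: "orlicz_norm M \<psi> X < ennreal s"
  shows "(\<integral>\<^sup>+\<omega>. ennreal (\<psi> (\<bar>X \<omega>\<bar> / s)) \<partial>M) < 1"
proof -
  obtain t where t: "0 < t" "ennreal t < ennreal s" "(\<integral>\<^sup>+\<omega>. ennreal (\<psi> (\<bar>X \<omega>\<bar> / t)) \<partial>M) \<le> 1"
    using less unfolding orlicz_norm_def Inf_less_iff by blast
  have "t < s"
    using t by (simp add: ennreal_less_iff)
  have [measurable]: "(\<lambda>\<omega>. \<psi> (\<bar>X \<omega>\<bar> / t)) \<in> borel_measurable M"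
    by (rule measurable_orlicz_scaled) (use assms t in auto)
  have "\<psi> (\<bar>X \<omega>\<bar> / s) \<le> (t / s) * \<psi> (\<bar>X \<omega>\<bar> / t)" for \<omega>
    using orlicz_scale[OF \<psi>, of "\<bar>X \<omega>\<bar> / t" "t / s"] t \<open>t < s\<close> by simp
  then have "(\<integral>\<^sup>+\<omega>. ennreal (\<psi> (\<bar>X \<omega>\<bar> / s)) \<partial>M) \<le> (\<integral>\<^sup>+\<omega>. ennreal (t / s) * ennreal (\<psi> (\<bar>X \<omega>\<bar> / t)) \<partial>M)"
    using t \<open>t < s\<close> by (intro nn_integral_mono) (simp flip: ennreal_mult' add: ennreal_leI)
  also have "\<dots> = ennreal (t / s) * (\<integral>\<^sup>+\<omega>. ennreal (\<psi> (\<bar>X \<omega>\<bar> / t)) \<partial>M)"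
    by (rule nn_integral_cmult) simp
  also have "\<dots> \<le> ennreal (t / s) * 1"
    using t(3) by (rule mult_left_mono) simp
  also have "\<dots> < 1"
    using t \<open>t < s\<close> by (simp add: ennreal_less_one_iff)
  finally show ?thesis .
qed

lemma nn_integral_orlicz_greater_one:
  assumes "0 < s" "ennreal s < orlicz_norm M \<psi> X"
  shows "1 < (\<integral>\<^sup>+\<omega>. ennreal (\<psi> (\<bar>X \<omega>\<bar> / s)) \<partial>M)"
proof (rule ccontr)
  assume "\<not> ?thesis"
  then have "orlicz_norm M \<psi> X \<le> ennreal s"
    unfolding orlicz_norm_def using assms(1) by (intro Inf_lower) auto
  with assms(2) show False
    by simp
qed

lemma ennreal_finite_less:
  assumes "a < (\<infinity>::ennreal)"
  obtains s where "0 < s" "a < ennreal s"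
proof -
  have "a < ennreal (enn2real a + 1)"
    using assms by (cases a) (auto simp: ennreal_less_iff)
  then show ?thesis
    using that[of "enn2real a + 1"] by (simp add: add_nonneg_pos)
qed

text \<open>The Euclidean norm is at most the sum of the absolute coordinates, and that sum over
  \<open>d * T\<close> is the average of the \<open>d\<close> coordinates scaled by
  \<open>T\<close>. Jensen's inequality then bounds the expectation by an average of numbers at most
  1.\<close>

lemma orlicz_norm_norm_finite:
  fixes Z :: "'a \<Rightarrow> real ^ 'd"
  assumes \<psi>: "orlicz_function \<psi>" and Z[measurable]: "Z \<in> borel_measurable M"
    and fin: "\<And>j. orlicz_norm M \<psi> (\<lambda>\<omega>. Z \<omega> $ j) < \<infinity>"
  shows "orlicz_norm M \<psi> (\<lambda>\<omega>. norm (Z \<omega>)) < \<infinity>"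
proof -
  have "\<exists>t. 0 < t \<and> orlicz_norm M \<psi> (\<lambda>\<omega>. Z \<omega> $ j) < ennreal t" for j
    using fin by (metis ennreal_finite_less)
  then obtain t where t: "0 < t j" "orlicz_norm M \<psi> (\<lambda>\<omega>. Z \<omega> $ j) < ennreal (t j)" for j
    by metis
  \<comment> \<open>A single scale above every \<open>t j\<close>, so that all coordinates can be
    averaged together.\<close>
  define T where "T = (\<Sum>j\<in>UNIV. t j)"
  define d where "d = real CARD('d)"
  have tT: "t j \<le> T" for j
    unfolding T_def by (rule member_le_sum) (auto intro: less_imp_le t)
  then have T: "0 < T"
    using t(1) by (meson less_le_trans)
  have d: "0 < d"
    by (simp add: d_def)
  have [measurable]: "(\<lambda>\<omega>. Z \<omega> $ j) \<in> borel_measurable M" for j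
    by (rule measurable_compose[OF Z]) (intro borel_measurable_continuous_onI continuous_intros)
  have [measurable]: "(\<lambda>\<omega>. \<psi> (\<bar>Z \<omega> $ j\<bar> / T)) \<in> borel_measurable M" for j
    by (rule measurable_orlicz_scaled[OF \<psi> _ T]) simp
  have le1: "(\<integral>\<^sup>+\<omega>. ennreal (\<psi> (\<bar>Z \<omega> $ j\<bar> / T)) \<partial>M) \<le> 1" for j
    using t(2)[of j] tT[of j]
    by (intro less_imp_le nn_integral_orlicz_less_one[OF \<psi>]) (auto intro: less_le_trans ennreal_leI)
  have "\<psi> (\<bar>norm (Z \<omega>)\<bar> / (d * T)) \<le> (\<Sum>j\<in>UNIV. (1 / d) * \<psi> (\<bar>Z \<omega> $ j\<bar> / T))" for \<omega>
  proof -
    have "norm (Z \<omega>) / (d * T) \<le> (\<Sum>j\<in>UNIV. \<bar>Z \<omega> $ j\<bar>) / (d * T)"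
      using d T by (intro divide_right_mono norm_le_l1_cart) simp
    also have "\<dots> = (\<Sum>j\<in>UNIV. (1 / d) *\<^sub>R (\<bar>Z \<omega> $ j\<bar> / T))"
      by (simp add: sum_divide_distrib)
    finally have "\<psi> (\<bar>norm (Z \<omega>)\<bar> / (d * T)) \<le> \<psi> (\<Sum>j\<in>UNIV. (1 / d) *\<^sub>R (\<bar>Z \<omega> $ j\<bar> / T))"
      using d T by (intro orlicz_mono[OF \<psi>]) auto
    also have "\<dots> \<le> (\<Sum>j\<in>UNIV. (1 / d) * \<psi> (\<bar>Z \<omega> $ j\<bar> / T))"
      using d T by (intro convex_on_sum[OF _ _ orlicz_convex[OF \<psi>]]) (auto simp: d_def)
    finally show ?thesis .
  qed
  then have "(\<integral>\<^sup>+\<omega>. ennreal (\<psi> (\<bar>norm (Z \<omega>)\<bar> / (d * T))) \<partial>M)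
      \<le> (\<integral>\<^sup>+\<omega>. (\<Sum>j\<in>UNIV. ennreal (1 / d) * ennreal (\<psi> (\<bar>Z \<omega> $ j\<bar> / T))) \<partial>M)"
    using d T orlicz_nonneg[OF \<psi>]
    by (intro nn_integral_mono) (simp flip: ennreal_mult add: ennreal_leI)
  also have "\<dots> = (\<Sum>j\<in>UNIV. ennreal (1 / d) * (\<integral>\<^sup>+\<omega>. ennreal (\<psi> (\<bar>Z \<omega> $ j\<bar> / T)) \<partial>M))"
    by (simp add: nn_integral_sum nn_integral_cmult)
  also have "\<dots> \<le> (\<Sum>j\<in>(UNIV::'d set). ennreal (1 / d) * 1)"
    using le1 by (intro sum_mono mult_left_mono) auto
  also have "\<dots> = ennreal (d * (1 / d))"
    using d by (simp add: d_def ennreal_of_nat_eq_real_of_nat flip: ennreal_mult)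
  also have "\<dots> = 1"
    using d by simp
  finally have "orlicz_norm M \<psi> (\<lambda>\<omega>. norm (Z \<omega>)) \<le> ennreal (d * T)"
    unfolding orlicz_norm_def using d T by (intro Inf_lower) auto
  then show ?thesis
    by (simp add: order_le_less_trans)
qed

section \<open>Admissible scales of a sample\<close>

definition orlicz_admissible :: "(real \<Rightarrow> real) \<Rightarrow> nat \<Rightarrow> (nat \<Rightarrow> real) \<Rightarrow> real \<Rightarrow> bool" where
  "orlicz_admissible \<psi> n x s \<longleftrightarrow> 0 < s \<and> (1 / real n) * (\<Sum>i=1..n. \<psi> (\<bar>x i\<bar> / s)) \<le> 1"

lemma empirical_orlicz_norm_eq:
  "empirical_orlicz_norm \<psi> n x = Inf {ennreal s |s. orlicz_admissible \<psi> n x s}"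
  by (simp add: empirical_orlicz_norm_def orlicz_admissible_def)

text \<open>Comparing quotients serves both a larger scale for the same data and data dominated by a
  multiple of other data.\<close>

lemma orlicz_admissible_mono:
  assumes \<psi>: "orlicz_function \<psi>" and adm: "orlicz_admissible \<psi> n y t" and "0 < s"
    and le: "\<And>i. 1 \<le> i \<Longrightarrow> \<bar>x i\<bar> / s \<le> \<bar>y i\<bar> / t"
  shows "orlicz_admissible \<psi> n x s"
proof -
  have "(1 / real n) * (\<Sum>i=1..n. \<psi> (\<bar>x i\<bar> / s)) \<le> (1 / real n) * (\<Sum>i=1..n. \<psi> (\<bar>y i\<bar> / t))"
    using le \<open>0 < s\<close> by (intro mult_left_mono sum_mono orlicz_mono[OF \<psi>]) auto
  with adm \<open>0 < s\<close> show ?thesis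
    by (auto simp: orlicz_admissible_def)
qed

lemma orlicz_admissible_scale:
  assumes \<psi>: "orlicz_function \<psi>" and "orlicz_admissible \<psi> n x t" "t \<le> s"
  shows "orlicz_admissible \<psi> n x s"
  using assms by (intro orlicz_admissible_mono[OF \<psi> assms(2)])
    (auto simp: orlicz_admissible_def intro!: divide_left_mono)

text \<open>The triangle inequality for scales: the sum over \<open>s + t\<close> is a convex
  combination of the parts over \<open>s\<close> and \<open>t\<close>, with weights proportional to
  \<open>s\<close> and \<open>t\<close>. No infimum has to be attained.\<close>

lemma orlicz_admissible_add:
  assumes \<psi>: "orlicz_function \<psi>"
    and x: "orlicz_admissible \<psi> n x s" and y: "orlicz_admissible \<psi> n y t"
  shows "orlicz_admissible \<psi> n (\<lambda>i. x i + y i) (s + t)"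
proof -
  have s: "0 < s" and t: "0 < t"
    using x y by (auto simp: orlicz_admissible_def)
  define l where "l = t / (s + t)"
  have l: "0 \<le> l" "l \<le> 1"
    using s t by (auto simp: l_def)
  have "\<psi> (\<bar>x i + y i\<bar> / (s + t)) \<le> (1 - l) * \<psi> (\<bar>x i\<bar> / s) + l * \<psi> (\<bar>y i\<bar> / t)" for i
  proof -
    have "(1 - l) * (\<bar>x i\<bar> / s) + l * (\<bar>y i\<bar> / t) = (\<bar>x i\<bar> + \<bar>y i\<bar>) / (s + t)"
      using s t by (simp add: l_def divide_simps)
    then have "\<psi> (\<bar>x i + y i\<bar> / (s + t)) \<le> \<psi> ((1 - l) *\<^sub>R (\<bar>x i\<bar> / s) + l *\<^sub>R (\<bar>y i\<bar> / t))"
      using s t by (intro orlicz_mono[OF \<psi>]) (auto intro: divide_right_mono)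
    also have "\<dots> \<le> (1 - l) * \<psi> (\<bar>x i\<bar> / s) + l * \<psi> (\<bar>y i\<bar> / t)"
      using l s t by (intro convex_onD[OF orlicz_convex[OF \<psi>]]) auto
    finally show ?thesis .
  qed
  then have "(1 / real n) * (\<Sum>i=1..n. \<psi> (\<bar>x i + y i\<bar> / (s + t)))
      \<le> (1 / real n) * (\<Sum>i=1..n. (1 - l) * \<psi> (\<bar>x i\<bar> / s) + l * \<psi> (\<bar>y i\<bar> / t))"
    by (intro mult_left_mono sum_mono) auto
  also have "\<dots> = (1 - l) * ((1 / real n) * (\<Sum>i=1..n. \<psi> (\<bar>x i\<bar> / s)))
      + l * ((1 / real n) * (\<Sum>i=1..n. \<psi> (\<bar>y i\<bar> / t)))"
    by (simp add: sum.distrib add_divide_distrib flip: sum_distrib_left)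
  also have "\<dots> \<le> (1 - l) * 1 + l * 1"
    using x y l by (intro add_mono mult_left_mono) (auto simp: orlicz_admissible_def)
  finally show ?thesis
    using s t by (simp add: orlicz_admissible_def)
qed

section \<open>Admissibility for large samples, and its stability under perturbation\<close>

lemma (in prob_space) iid_orlicz:
  assumes "orlicz_function \<psi>" "iid_seq M borel X" "0 < s"
  shows "iid_seq M borel (\<lambda>i \<omega>. \<psi> (\<bar>X i \<omega>\<bar> / s))"
  using assms(2) by (rule iid_seq_compose) (rule measurable_orlicz_scaled, use assms in auto)

lemma (in prob_space) AE_eventually_admissible:
  assumes \<psi>: "orlicz_function \<psi>" and X: "iid_seq M borel X"
    and less: "orlicz_norm M \<psi> (X 1) < ennreal s"
  shows "AE \<omega> in M. \<forall>\<^sub>F n in sequentially. orlicz_admissible \<psi> n (\<lambda>i. X i \<omega>) s"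
proof -
  \<comment> \<open>\<open>ennreal\<close> sends nonpositive reals to 0, and nothing lies strictly
    below 0.\<close>
  have s: "0 < s"
    using less by (metis ennreal_neg leI not_less_zero)
  have "AE \<omega> in M. \<forall>\<^sub>F n in sequentially. (1 / real n) * (\<Sum>i=1..n. \<psi> (\<bar>X i \<omega>\<bar> / s)) < 1"
    using s less iid_seq_measurable[OF X, of 1]
    by (intro iid_mean_less_one iid_orlicz[OF \<psi> X] orlicz_nonneg[OF \<psi>]
        nn_integral_orlicz_less_one[OF \<psi>]) auto
  then show ?thesis
    using s by (auto simp: orlicz_admissible_def elim!: eventually_mono)
qed

lemma (in prob_space) AE_eventually_not_admissible:
  assumes \<psi>: "orlicz_function \<psi>" and X: "iid_seq M borel X"
    and s: "0 < s" and less: "ennreal s < orlicz_norm M \<psi> (X 1)"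
  shows "AE \<omega> in M. \<forall>\<^sub>F n in sequentially. \<not> orlicz_admissible \<psi> n (\<lambda>i. X i \<omega>) s"
proof -
  have "AE \<omega> in M. \<forall>\<^sub>F n in sequentially. 1 < (1 / real n) * (\<Sum>i=1..n. \<psi> (\<bar>X i \<omega>\<bar> / s))"
    using s less
    by (intro iid_mean_greater_one iid_orlicz[OF \<psi> X] orlicz_nonneg[OF \<psi>]
        nn_integral_orlicz_greater_one) auto
  then show ?thesis
    by (auto simp: orlicz_admissible_def elim!: eventually_mono)
qed

text \<open>Rational scales keep the number of exceptional null sets countable.\<close>

lemma ennreal_Rats_dense:
  fixes a b :: ennreal
  assumes "a < b"
  obtains s :: real where "s \<in> \<rat>" "0 < s" "a < ennreal s" "ennreal s < b"
proof -
  obtain r :: rat where r: "a < ennreal (real_of_rat r)" "ennreal (real_of_rat r) < b"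
    using ennreal_rat_dense[OF assms] by blast
  have "0 < real_of_rat r"
    using r(1) by (metis ennreal_neg leI not_less_zero)
  then show ?thesis
    using r that[of "real_of_rat r"] by simp
qed

text \<open>The deterministic part, along one outcome: \<open>e\<close> stands for the errors,
  \<open>r n\<close> for the residuals at sample size \<open>n\<close>, \<open>w\<close> for the
  covariate norms and \<open>c n\<close> for the estimation error.\<close>

lemma empirical_orlicz_norm_perturb_tendsto:
  assumes \<psi>: "orlicz_function \<psi>"
    and upper: "\<And>s. s \<in> \<rat> \<Longrightarrow> L < ennreal s \<Longrightarrow> \<forall>\<^sub>F n in sequentially. orlicz_admissible \<psi> n e s"
    and lower: "\<And>s. s \<in> \<rat> \<Longrightarrow> 0 < s \<Longrightarrow> ennreal s < L \<Longrightarrow>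
      \<forall>\<^sub>F n in sequentially. \<not> orlicz_admissible \<psi> n e s"
    and w: "\<forall>\<^sub>F n in sequentially. orlicz_admissible \<psi> n w t" and "0 < t"
    and c: "c \<longlonglongrightarrow> (0::real)"
    and le: "\<And>n i. 1 \<le> i \<Longrightarrow> \<bar>r n i - e i\<bar> \<le> c n * \<bar>w i\<bar>"
  shows "(\<lambda>n. empirical_orlicz_norm \<psi> n (r n)) \<longlonglongrightarrow> L"
proof -
  \<comment> \<open>One sign recovers residuals from errors, the other errors from
    residuals.\<close>
  have small: "\<forall>\<^sub>F n in sequentially. orlicz_admissible \<psi> n (\<lambda>i. r n i - e i) \<delta> \<and>
      orlicz_admissible \<psi> n (\<lambda>i. e i - r n i) \<delta>" if "0 < \<delta>" for \<delta>
  proof -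
    have "\<forall>\<^sub>F n in sequentially. c n < \<delta> / t"
      using c that \<open>0 < t\<close> by (intro order_tendstoD) auto
    with w show ?thesis
    proof eventually_elim
      case (elim n)
      have "\<bar>r n i - e i\<bar> / \<delta> \<le> \<bar>w i\<bar> / t" if "1 \<le> i" for i
      proof -
        \<comment> \<open>Once \<open>c n < \<delta> / t\<close>, admissibility of \<open>t\<close>
          for \<open>w\<close> yields that of \<open>\<delta>\<close> for the difference.\<close>
        have "\<bar>r n i - e i\<bar> \<le> (\<delta> / t) * \<bar>w i\<bar>"
          using le[OF that, of n] elim(2) by (meson abs_ge_zero less_imp_le mult_right_mono order_trans)
        then show ?thesis
          using \<open>0 < \<delta>\<close> by (simp add: field_simps)
      qed
      then show ?case
        using that by (auto intro!: orlicz_admissible_mono[OF \<psi> elim(1)] simp: abs_minus_commute)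
    qed
  qed
  show ?thesis
  proof (rule order_tendstoI)
    fix a assume "L < a"
    then obtain s where s: "s \<in> \<rat>" "0 < s" "L < ennreal s" "ennreal s < a"
      by (rule ennreal_Rats_dense)
    \<comment> \<open>The errors use the scale \<open>s'\<close>, and the gap \<open>s - s'\<close>
      is left for the perturbation.\<close>
    obtain s' where s': "s' \<in> \<rat>" "0 < s'" "L < ennreal s'" "ennreal s' < ennreal s"
      using s(3) by (rule ennreal_Rats_dense)
    have "0 < s - s'"
      using s' by (simp add: ennreal_less_iff)
    from upper[OF s'(1,3)] small[OF this]
    show "\<forall>\<^sub>F n in sequentially. empirical_orlicz_norm \<psi> n (r n) < a"
    proof eventually_elim
      case (elim n)
      have "orlicz_admissible \<psi> n (r n) s"
        using orlicz_admissible_add[OF \<psi> elim(1) conjunct1[OF elim(2)]] by simp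
      then have "empirical_orlicz_norm \<psi> n (r n) \<le> ennreal s"
        unfolding empirical_orlicz_norm_eq by (intro Inf_lower) auto
      with s(4) show ?case
        by simp
    qed
  next
    fix a assume "a < L"
    then obtain s where s: "s \<in> \<rat>" "0 < s" "a < ennreal s" "ennreal s < L"
      by (rule ennreal_Rats_dense)
    obtain s' where s': "s' \<in> \<rat>" "0 < s'" "ennreal s < ennreal s'" "ennreal s' < L"
      using s(4) by (rule ennreal_Rats_dense)
    have "0 < s' - s"
      using s' s(2) by (simp add: ennreal_less_iff)
    from lower[OF s'(1,2,4)] small[OF this]
    show "\<forall>\<^sub>F n in sequentially. a < empirical_orlicz_norm \<psi> n (r n)"
    proof eventually_elim
      case (elim n)
      \<comment> \<open>Otherwise adding the gap would make \<open>s'\<close> admissible for the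
        errors. As admissible scales are closed upwards, all those of the residuals then lie above
        \<open>s\<close>.\<close>
      have "\<not> orlicz_admissible \<psi> n (r n) s"
        using orlicz_admissible_add[OF \<psi> _ conjunct2[OF elim(2)], of "r n" s] elim(1) by auto
      then have "s \<le> u" if "orlicz_admissible \<psi> n (r n) u" for u
        using orlicz_admissible_scale[OF \<psi> that, of s] by linarith
      then have "ennreal s \<le> empirical_orlicz_norm \<psi> n (r n)"
        unfolding empirical_orlicz_norm_eq by (intro Inf_greatest) (auto intro: ennreal_leI)
      with s(3) show ?case
        by simp
    qed
  qed
qed

text \<open>Errors are tied to \<open>\<epsilon>\<close> only through their law, so the norm has to
  be carried over to the first error.\<close>

lemma orlicz_norm_distr_eq:
  assumes \<psi>: "orlicz_function \<psi>"
    and X[measurable]: "X \<in> borel_measurable M" and Y[measurable]: "Y \<in> borel_measurable M"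
    and law: "distr M borel X = distr M borel Y"
  shows "orlicz_norm M \<psi> X = orlicz_norm M \<psi> Y"
proof -
  have "(\<integral>\<^sup>+\<omega>. ennreal (\<psi> (\<bar>X \<omega>\<bar> / s)) \<partial>M) = (\<integral>\<^sup>+\<omega>. ennreal (\<psi> (\<bar>Y \<omega>\<bar> / s)) \<partial>M)" if "0 < s" for s
  proof -
    have [measurable]: "(\<lambda>x. \<psi> (\<bar>x\<bar> / s)) \<in> borel_measurable borel"
      by (rule measurable_orlicz_scaled[OF \<psi> _ that]) simp
    have "(\<integral>\<^sup>+\<omega>. ennreal (\<psi> (\<bar>X \<omega>\<bar> / s)) \<partial>M) = (\<integral>\<^sup>+x. ennreal (\<psi> (\<bar>x\<bar> / s)) \<partial>distr M borel X)"
      by (subst nn_integral_distr) auto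
    also have "\<dots> = (\<integral>\<^sup>+\<omega>. ennreal (\<psi> (\<bar>Y \<omega>\<bar> / s)) \<partial>M)"
      unfolding law by (subst nn_integral_distr) auto
    finally show ?thesis .
  qed
  then show ?thesis
    unfolding orlicz_norm_def by (metis (no_types, lifting))
qed

section \<open>Application to the regression residuals\<close>

theorem theorem2p2:
  fixes M :: "'a measure"
    and \<psi> :: "real \<Rightarrow> real"
    and \<beta> :: "real ^ 'd"
    and Y :: "nat \<Rightarrow> 'a \<Rightarrow> real"
    and Z :: "nat \<Rightarrow> 'a \<Rightarrow> real ^ 'd"
    and \<epsilon>s :: "nat \<Rightarrow> 'a \<Rightarrow> real"
    and \<epsilon> :: "'a \<Rightarrow> real"
    and \<beta>hat :: "nat \<Rightarrow> 'a \<Rightarrow> real ^ 'd"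
  assumes "prob_space M"
    and "orlicz_function \<psi>"
    and model: "\<And>i \<omega>. i \<ge> 1 \<Longrightarrow> \<omega> \<in> space M \<Longrightarrow> Y i \<omega> = \<beta> \<bullet> Z i \<omega> + \<epsilon>s i \<omega>"
    and "iid_seq M borel \<epsilon>s"
    and "\<epsilon> \<in> borel_measurable M"
    and "\<And>i. i \<ge> 1 \<Longrightarrow> distr M borel (\<epsilon>s i) = distr M borel \<epsilon>"
    and centered: "integrable M \<epsilon>" "prob_space.expectation M \<epsilon> = 0"
    and "iid_seq M borel Z"
    and "\<And>n. \<beta>hat n \<in> borel_measurable M"
    and "AE \<omega> in M. (\<lambda>n. \<beta>hat n \<omega>) \<longlonglongrightarrow> \<beta>"
    and "orlicz_norm M \<psi> \<epsilon> < \<infinity>"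
    and "\<And>i j. i \<ge> 1 \<Longrightarrow> orlicz_norm M \<psi> (\<lambda>\<omega>. Z i \<omega> $ j) < \<infinity>"
  shows "AE \<omega> in M.
    (\<lambda>n. empirical_orlicz_norm \<psi> n (\<lambda>i. Y i \<omega> - \<beta>hat n \<omega> \<bullet> Z i \<omega>))
      \<longlonglongrightarrow> orlicz_norm M \<psi> \<epsilon>"
proof -
  interpret prob_space M
    by fact
  note \<psi> = \<open>orlicz_function \<psi>\<close>
  note \<epsilon>s = \<open>iid_seq M borel \<epsilon>s\<close>
  note Z = \<open>iid_seq M borel Z\<close>
  define L where "L = orlicz_norm M \<psi> \<epsilon>"
  have L: "orlicz_norm M \<psi> (\<epsilon>s 1) = L"
    unfolding L_def using iid_seq_measurable[OF \<epsilon>s] assms(5,6)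
    by (intro orlicz_norm_distr_eq[OF \<psi>]) auto
  have upper: "AE \<omega> in M. \<forall>s\<in>\<rat>. L < ennreal s \<longrightarrow> (\<forall>\<^sub>F n in sequentially. orlicz_admissible \<psi> n (\<lambda>i. \<epsilon>s i \<omega>) s)"
    using AE_eventually_admissible[OF \<psi> \<epsilon>s, unfolded L]
    by (subst AE_ball_countable) (auto simp: countable_rat)
  have lower: "AE \<omega> in M. \<forall>s\<in>\<rat>. 0 < s \<and> ennreal s < L \<longrightarrow>
      (\<forall>\<^sub>F n in sequentially. \<not> orlicz_admissible \<psi> n (\<lambda>i. \<epsilon>s i \<omega>) s)"
    using AE_eventually_not_admissible[OF \<psi> \<epsilon>s, unfolded L]
    by (subst AE_ball_countable) (auto simp: countable_rat)
  have norm_Z: "iid_seq M borel (\<lambda>i \<omega>. norm (Z i \<omega>))"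
    by (rule iid_seq_compose[OF Z]) simp
  have "orlicz_norm M \<psi> (\<lambda>\<omega>. norm (Z 1 \<omega>)) < \<infinity>"
    using iid_seq_measurable[OF Z] assms(13) by (intro orlicz_norm_norm_finite[OF \<psi>]) auto
  then obtain t where t: "0 < t" "orlicz_norm M \<psi> (\<lambda>\<omega>. norm (Z 1 \<omega>)) < ennreal t"
    by (rule ennreal_finite_less)
  have w: "AE \<omega> in M. \<forall>\<^sub>F n in sequentially. orlicz_admissible \<psi> n (\<lambda>i. norm (Z i \<omega>)) t"
    using AE_eventually_admissible[OF \<psi> norm_Z t(2)] .
  \<comment> \<open>\<open>AE_space\<close> supplies membership in the sample space, where the model
    equation holds.\<close>
  from upper lower w assms(11) AE_space show ?thesis
    unfolding L_def[symmetric]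
  proof eventually_elim
    case (elim \<omega>)
    show ?case
    proof (rule empirical_orlicz_norm_perturb_tendsto[OF \<psi> _ _ elim(3) t(1)])
      show "(\<lambda>n. norm (\<beta> - \<beta>hat n \<omega>)) \<longlonglongrightarrow> 0"
        using tendsto_norm[OF tendsto_diff[OF tendsto_const[of \<beta>] elim(4)]] by simp
      \<comment> \<open>By the model equation the difference is the inner product of
        \<open>\<beta> - \<beta>hat n \<omega>\<close> with \<open>Z i \<omega>\<close>, so
        Cauchy-Schwarz applies.\<close>
      show "\<bar>Y i \<omega> - \<beta>hat n \<omega> \<bullet> Z i \<omega> - \<epsilon>s i \<omega>\<bar> \<le> norm (\<beta> - \<beta>hat n \<omega>) * \<bar>norm (Z i \<omega>)\<bar>"
        if "1 \<le> i" for n i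
        using Cauchy_Schwarz_ineq2[of "\<beta> - \<beta>hat n \<omega>" "Z i \<omega>"] model[OF that elim(5)]
        by (simp add: inner_diff_left)
    qed (use elim(1,2) in auto)
  qed
qed

end
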